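(* Let $\mathbb{K}$ be a field, $d\ge 0$ an integer, $\mathcal{A}$ a $\mathbb{K}$-algebra isomorphic to $\mathrm{Mat}_{d+1}(\mathbb{K})$, and let $\Phi=(A;\{E_i\}_{i=0}^d;A^*;\{E^*_i\}_{i=0}^d)$ be a Leonard system in $\mathcal{A}$ with eigenvalue sequence $\{\theta_i\}_{i=0}^d$, dual eigenvalue sequence $\{\theta^*_i\}_{i=0}^d$ and first split sequence $\{\varphi_i\}_{i=1}^d$. Let $\Delta_{i,j}\in\mathcal{A}$ $(0\le i,j\le d)$ be the matrix units associated with the $\Phi$-split basis. Let $\nu$ and $\nu^{\downarrow\Downarrow}$ denote the multiplicative inverses of $\mathrm{tr}(E^*_0E_0)$ and $\mathrm{tr}(E^*_dE_d)$ respectively. Then for $0\le i,j\le d$, $\Delta_{i,j}$ is equal to each of $$\frac{\nu\,\tau_i(A)E^*_0E_0\tau^*_j(A^* )}{\varphi_1\varphi_2\cdots\varphi_j},\qquad\qquad \frac{\nu^{\downarrow\Downarrow}\,\eta^*_{d-i}(A^* )E_dE^*_d\,\eta_{d-j}(A)}{\varphi_d\varphi_{d-1}\cdots\varphi_{i+1}}.$$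
   Context: Notation: $A^*$ is just the name of an element (not the conjugate-transpose of $A$). Empty products equal $1$. $V$ denotes a simple $\mathcal{A}$-module (unique up to isomorphism, of dimension $d+1$ over $\mathbb{K}$); $\mathrm{tr}$ is the trace of the action on $V$. Rows and columns of matrices in $\mathrm{Mat}_{d+1}(\mathbb{K})$ are indexed by $0,1,\dots,d$. Primitive idempotents. An element $A\in\mathcal{A}$ is multiplicity-free if it has $d+1$ mutually distinct eigenvalues in $\mathbb{K}$. If $\theta_0,\dots,\theta_d$ is an ordering of these eigenvalues, the primitive idempotent of $A$ associated with $\theta_i$ is $E_i=\prod_{0\le j\le d,\ j\ne i}\frac{A-\theta_jI}{\theta_i-\theta_j}$. Leonard system. A Leonard system in $\mathcal{A}$ is a sequence $\Phi=(A;\{E_i\}_{i=0}^d;A^*;\{E^*_i\}_{i=0}^d)$ such that: (i) $A,A^*\in\mathcal{A}$ are both multiplicity-free; (ii) $E_0,\dots,E_d$ is an ordering of the primitive idempotents of $A$; (iii) $E^*_0,\dots,E^*_d$ is an ordering of the primitive idempotents of $A^*$; (iv) for $0\le i,j\le d$, $E_iA^*E_j=0$ if $|i-j|>1$ and $E_iA^*E_j\neq0$ if $|i-j|=1$; (v) for $0\le i,j\le d$, $E^*_iAE^*_j=0$ if $|i-j|>1$ and $E^*_iAE^*_j\ne0$ if $|i-j|=1$. Eigenvalues and first split sequence. $\theta_i$ is the eigenvalue of $A$ associated with $E_i$, and $\theta^*_i$ is the eigenvalue of $A^*$ associated with $E^*_i$. For $0\le i\le d$ put $U_i=(E^*_0V+\cdots+E^*_iV)\cap(E_iV+\cdots+E_dV)$.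 It is known that each $U_i$ is $1$-dimensional, $V=U_0\oplus\cdots\oplus U_d$, $(A-\theta_iI)U_i=U_{i+1}$ $(0\le i\le d-1)$, $(A-\theta_dI)U_d=0$, $(A^*-\theta^*_iI)U_i=U_{i-1}$ $(1\le i\le d)$, $(A^*-\theta^*_0I)U_0=0$. For $1\le i\le d$, $\varphi_i$ denotes the (nonzero) eigenvalue of $(A-\theta_{i-1}I)(A^*-\theta^*_iI)$ on $U_i$; $\varphi_1,\dots,\varphi_d$ is the first split sequence of $\Phi$. Split basis and matrix units. A $\Phi$-split basis of $V$ is a basis $u_0,\dots,u_d$ with $0\ne u_i\in U_i$ for all $i$ and $(A-\theta_iI)u_i=u_{i+1}$ $(0\le i\le d-1)$ (so also $(A-\theta_dI)u_d=0$, $(A^*-\theta^*_iI)u_i=\varphi_iu_{i-1}$ for $1\le i\le d$, and $(A^*-\theta^*_0I)u_0=0$); it is unique up to multiplying all $u_i$ by one common nonzero scalar. For $X\in\mathcal{A}$, $X^\natural\in\mathrm{Mat}_{d+1}(\mathbb{K})$ is the matrix representing $X$ with respect to this basis, i.e. $Xu_j=\sum_{i=0}^d(X^\natural)_{ij}u_i$. $\Delta_{i,j}$ is the element of $\mathcal{A}$ such that $(\Delta_{i,j})^\natural$ has $(i,j)$-entry $1$ and all other entries $0$. The scalars $\nu$, $\nu^{\downarrow\Downarrow}$. It is known that $\mathrm{tr}(E^*_0E_0)\neq0$; $\nu$ is its inverse. $\nu^{\downarrow\Downarrow}$ is the same quantity for the Leonard system $(A;\{E_{d-i}\}_{i=0}^d;A^*;\{E^*_{d-i}\}_{i=0}^d)$,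 so $\nu^{\downarrow\Downarrow}=\mathrm{tr}(E^*_dE_d)^{-1}$ (with $\mathrm{tr}(E^*_dE_d)\ne0$). Polynomials. For $0\le i\le d$, in $\mathbb{K}[\lambda]$: $\tau_i=(\lambda-\theta_0)(\lambda-\theta_1)\cdots(\lambda-\theta_{i-1})$, $\eta_i=(\lambda-\theta_d)(\lambda-\theta_{d-1})\cdots(\lambda-\theta_{d-i+1})$, $\tau^*_i=(\lambda-\theta^*_0)(\lambda-\theta^*_1)\cdots(\lambda-\theta^*_{i-1})$, $\eta^*_i=(\lambda-\theta^*_d)(\lambda-\theta^*_{d-1})\cdots(\lambda-\theta^*_{d-i+1})$. *)

theory Defs
  imports "Jordan_Normal_Form.Matrix" "HOL-Computational_Algebra.Polynomial"
begin

section \<open>Algebras isomorphic to a full matrix algebra, and simple modules\<close>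

locale algebra_over_field = vector_space smul
  for smul :: "'k::field \<Rightarrow> 'a::ring_1 \<Rightarrow> 'a" +
  assumes smul_mult_left: "smul c x * y = smul c (x * y)"
    and smul_mult_right: "x * smul c y = smul c (x * y)"

definition iso_matrix_algebra :: "('k::field \<Rightarrow> 'a::ring_1 \<Rightarrow> 'a) \<Rightarrow> nat \<Rightarrow> bool" where
  "iso_matrix_algebra smul n \<longleftrightarrow>
     (\<exists>\<psi> :: 'a \<Rightarrow> 'k mat. bij_betw \<psi> UNIV (carrier_mat n n) \<and>
        (\<forall>x y. \<psi> (x + y) = \<psi> x + \<psi> y) \<and>
        (\<forall>x y. \<psi> (x * y) = \<psi> x * \<psi> y) \<and>
        \<psi> 1 = 1\<^sub>m n \<and>
        (\<forall>c x. \<psi> (smul c x) = c \<cdot>\<^sub>m \<psi> x))"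

text \<open>The library's locale of modules requires a commutative ring of scalars, so left modules over
  a noncommutative ring are introduced here.\<close>

locale left_module =
  fixes act :: "'a::ring_1 \<Rightarrow> 'v::ab_group_add \<Rightarrow> 'v"
  assumes act_add_right: "act x (v + w) = act x v + act x w"
    and act_add_left: "act (x + y) v = act x v + act y v"
    and act_mult: "act (x * y) v = act x (act y v)"
    and act_one: "act 1 v = v"

definition submodule :: "('a::ring_1 \<Rightarrow> 'v::ab_group_add \<Rightarrow> 'v) \<Rightarrow> 'v set \<Rightarrow> bool" where
  "submodule act W \<longleftrightarrow>
     0 \<in> W \<and> (\<forall>v\<in>W. \<forall>w\<in>W. v + w \<in> W) \<and> (\<forall>x. \<forall>v\<in>W. act x v \<in> W)"

locale simple_module = left_module act
  for act :: "'a::ring_1 \<Rightarrow> 'v::ab_group_add \<Rightarrow> 'v" +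
  assumes nontrivial: "\<exists>v::'v. v \<noteq> 0"
    and simple: "submodule act W \<Longrightarrow> W = {0} \<or> W = UNIV"

text \<open>A module over an algebra is a vector space through the scalars \<open>c 1\<close> of the algebra.\<close>

definition vscale ::
  "('k::field \<Rightarrow> 'a::ring_1 \<Rightarrow> 'a) \<Rightarrow> ('a \<Rightarrow> 'v::ab_group_add \<Rightarrow> 'v) \<Rightarrow> 'k \<Rightarrow> 'v \<Rightarrow> 'v" where
  "vscale smul act c v = act (smul c 1) v"


section \<open>Linear algebra on the module\<close>

definition basis_set :: "('k::field \<Rightarrow> 'v::ab_group_add \<Rightarrow> 'v) \<Rightarrow> 'v set \<Rightarrow> bool" where
  "basis_set scale B \<longleftrightarrow>
     \<not> Modules.module.dependent scale B \<and> Modules.module.span scale B = UNIV"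

text \<open>Trace of the action of an element: the sum of the diagonal coefficients with respect to a
  basis, the choice of which does not matter.\<close>

definition tr ::
  "('k::field \<Rightarrow> 'a::ring_1 \<Rightarrow> 'a) \<Rightarrow> ('a \<Rightarrow> 'v::ab_group_add \<Rightarrow> 'v) \<Rightarrow> 'a \<Rightarrow> 'k" where
  "tr smul act x =
     (let scale = vscale smul act; B = (SOME B. basis_set scale B)
      in \<Sum>b\<in>B. Modules.module.representation scale B (act x b) b)"

definition eigenvalue_on ::
  "('k::field \<Rightarrow> 'a::ring_1 \<Rightarrow> 'a) \<Rightarrow> ('a \<Rightarrow> 'v::ab_group_add \<Rightarrow> 'v) \<Rightarrow> 'a \<Rightarrow> 'v set \<Rightarrow> 'k \<Rightarrow> bool" where
  "eigenvalue_on smul act x W c \<longleftrightarrow> (\<exists>w\<in>W. w \<noteq> 0 \<and> act x w = vscale smul act c w)"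

definition eigenvalues ::
  "('k::field \<Rightarrow> 'a::ring_1 \<Rightarrow> 'a) \<Rightarrow> ('a \<Rightarrow> 'v::ab_group_add \<Rightarrow> 'v) \<Rightarrow> 'a \<Rightarrow> 'k set" where
  "eigenvalues smul act x = {c. eigenvalue_on smul act x UNIV c}"


section \<open>Leonard systems\<close>

text \<open>Since \<open>card\<close> of an infinite set is \<open>0\<close>, this also says that the set of eigenvalues is finite.\<close>

definition multiplicity_free ::
  "('k::field \<Rightarrow> 'a::ring_1 \<Rightarrow> 'a) \<Rightarrow> ('a \<Rightarrow> 'v::ab_group_add \<Rightarrow> 'v) \<Rightarrow> nat \<Rightarrow> 'a \<Rightarrow> bool" where
  "multiplicity_free smul act d x \<longleftrightarrow> card (eigenvalues smul act x) = d + 1"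

text \<open>The product is taken over a list because the algebra is not commutative; the factors
  commute, so the order is immaterial.\<close>

definition primitive_idempotent ::
  "('k::field \<Rightarrow> 'a::ring_1 \<Rightarrow> 'a) \<Rightarrow> nat \<Rightarrow> 'a \<Rightarrow> (nat \<Rightarrow> 'k) \<Rightarrow> nat \<Rightarrow> 'a" where
  "primitive_idempotent smul d x \<theta> i =
     prod_list (map (\<lambda>j. smul (1 / (\<theta> i - \<theta> j)) (x - smul (\<theta> j) 1))
                    (filter (\<lambda>j. j \<noteq> i) [0..<d+1]))"

text \<open>\<open>\<theta>\<close> orders the eigenvalues of \<open>x\<close>, and \<open>E i\<close> is the primitive idempotent of \<open>x\<close> associated
  with \<open>\<theta> i\<close>. Here and below only the indices \<open>0, \<dots>, d\<close> of a sequence are relevant.\<close>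

definition eigenvalue_sequence ::
  "('k::field \<Rightarrow> 'a::ring_1 \<Rightarrow> 'a) \<Rightarrow> ('a \<Rightarrow> 'v::ab_group_add \<Rightarrow> 'v) \<Rightarrow> nat \<Rightarrow> 'a \<Rightarrow> (nat \<Rightarrow> 'a)
     \<Rightarrow> (nat \<Rightarrow> 'k) \<Rightarrow> bool" where
  "eigenvalue_sequence smul act d x E \<theta> \<longleftrightarrow>
     bij_betw \<theta> {..d} (eigenvalues smul act x) \<and>
     (\<forall>i\<le>d. E i = primitive_idempotent smul d x \<theta> i)"

definition leonard_system ::
  "('k::field \<Rightarrow> 'a::ring_1 \<Rightarrow> 'a) \<Rightarrow> ('a \<Rightarrow> 'v::ab_group_add \<Rightarrow> 'v) \<Rightarrow> nat
     \<Rightarrow> 'a \<Rightarrow> (nat \<Rightarrow> 'a) \<Rightarrow> 'a \<Rightarrow> (nat \<Rightarrow> 'a) \<Rightarrow> bool" where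
  "leonard_system smul act d A E As Es \<longleftrightarrow>
     multiplicity_free smul act d A \<and> multiplicity_free smul act d As \<and>
     (\<exists>\<theta>. eigenvalue_sequence smul act d A E \<theta>) \<and>
     (\<exists>\<theta>s. eigenvalue_sequence smul act d As Es \<theta>s) \<and>
     (\<forall>i\<le>d. \<forall>j\<le>d.
        (\<bar>int i - int j\<bar> > 1 \<longrightarrow> E i * As * E j = 0) \<and>
        (\<bar>int i - int j\<bar> = 1 \<longrightarrow> E i * As * E j \<noteq> 0)) \<and>
     (\<forall>i\<le>d. \<forall>j\<le>d.
        (\<bar>int i - int j\<bar> > 1 \<longrightarrow> Es i * A * Es j = 0) \<and>
        (\<bar>int i - int j\<bar> = 1 \<longrightarrow> Es i * A * Es j \<noteq> 0))"


section \<open>Split decomposition, split basis and matrix units\<close>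

definition split_space ::
  "('a::ring_1 \<Rightarrow> 'v::ab_group_add \<Rightarrow> 'v) \<Rightarrow> nat \<Rightarrow> (nat \<Rightarrow> 'a) \<Rightarrow> (nat \<Rightarrow> 'a) \<Rightarrow> nat \<Rightarrow> 'v set" where
  "split_space act d E Es i =
     {(\<Sum>h\<in>{0..i}. act (Es h) (w h)) |w. True} \<inter> {(\<Sum>h\<in>{i..d}. act (E h) (w h)) |w. True}"

definition first_split_sequence ::
  "('k::field \<Rightarrow> 'a::ring_1 \<Rightarrow> 'a) \<Rightarrow> ('a \<Rightarrow> 'v::ab_group_add \<Rightarrow> 'v) \<Rightarrow> nat
     \<Rightarrow> 'a \<Rightarrow> (nat \<Rightarrow> 'a) \<Rightarrow> 'a \<Rightarrow> (nat \<Rightarrow> 'a) \<Rightarrow> (nat \<Rightarrow> 'k) \<Rightarrow> (nat \<Rightarrow> 'k) \<Rightarrow> (nat \<Rightarrow> 'k) \<Rightarrow> bool" where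
  "first_split_sequence smul act d A E As Es \<theta> \<theta>s \<phi> \<longleftrightarrow>
     (\<forall>i\<in>{1..d}. eigenvalue_on smul act
        ((A - smul (\<theta> (i - 1)) 1) * (As - smul (\<theta>s i) 1)) (split_space act d E Es i) (\<phi> i))"

definition split_basis ::
  "('k::field \<Rightarrow> 'a::ring_1 \<Rightarrow> 'a) \<Rightarrow> ('a \<Rightarrow> 'v::ab_group_add \<Rightarrow> 'v) \<Rightarrow> nat
     \<Rightarrow> 'a \<Rightarrow> (nat \<Rightarrow> 'a) \<Rightarrow> (nat \<Rightarrow> 'a) \<Rightarrow> (nat \<Rightarrow> 'k) \<Rightarrow> (nat \<Rightarrow> 'v) \<Rightarrow> bool" where
  "split_basis smul act d A E Es \<theta> u \<longleftrightarrow>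
     inj_on u {..d} \<and> basis_set (vscale smul act) (u ` {..d}) \<and>
     (\<forall>i\<le>d. u i \<in> split_space act d E Es i \<and> u i \<noteq> 0) \<and>
     (\<forall>i<d. act (A - smul (\<theta> i) 1) (u i) = u (Suc i))"

text \<open>The matrix representing \<open>x\<close> with respect to the basis \<open>u 0, \<dots>, u d\<close>; column \<open>j\<close> consists of
  the coefficients of \<open>x u\<^sub>j\<close>.\<close>

definition natural_matrix ::
  "('k::field \<Rightarrow> 'a::ring_1 \<Rightarrow> 'a) \<Rightarrow> ('a \<Rightarrow> 'v::ab_group_add \<Rightarrow> 'v) \<Rightarrow> nat \<Rightarrow> (nat \<Rightarrow> 'v) \<Rightarrow> 'a \<Rightarrow> 'k mat" where
  "natural_matrix smul act d u x =
     mat (d+1) (d+1) (\<lambda>(i, j).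
       Modules.module.representation (vscale smul act) (u ` {..d}) (act x (u j)) (u i))"

definition matrix_unit ::
  "('k::field \<Rightarrow> 'a::ring_1 \<Rightarrow> 'a) \<Rightarrow> ('a \<Rightarrow> 'v::ab_group_add \<Rightarrow> 'v) \<Rightarrow> nat \<Rightarrow> (nat \<Rightarrow> 'v)
     \<Rightarrow> nat \<Rightarrow> nat \<Rightarrow> 'a" where
  "matrix_unit smul act d u i j =
     (THE x. natural_matrix smul act d u x =
        mat (d+1) (d+1) (\<lambda>(r, c). if r = i \<and> c = j then 1 else 0))"


section \<open>Polynomials\<close>

text \<open>The library function \<open>poly\<close> evaluates only at elements of the coefficient ring.\<close>

definition alg_eval :: "('k::field \<Rightarrow> 'a::ring_1 \<Rightarrow> 'a) \<Rightarrow> 'k poly \<Rightarrow> 'a \<Rightarrow> 'a" where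
  "alg_eval smul p x = (\<Sum>k\<le>degree p. smul (coeff p k) (x ^ k))"

definition tau :: "(nat \<Rightarrow> 'k::field) \<Rightarrow> nat \<Rightarrow> 'k poly" where
  "tau \<theta> i = (\<Prod>h<i. [:- \<theta> h, 1:])"

definition eta :: "nat \<Rightarrow> (nat \<Rightarrow> 'k::field) \<Rightarrow> nat \<Rightarrow> 'k poly" where
  "eta d \<theta> i = (\<Prod>h<i. [:- \<theta> (d - h), 1:])"

end

theory Submission
  imports Defs
begin

text \<open>Because the module is faithful, an element is known from its action on the split basis
  \<open>u\<^sub>0, \<dots>, u\<^sub>d\<close>, where \<open>A u\<^sub>i = \<theta>\<^sub>i u\<^sub>i + u\<^sub>i\<^sub>+\<^sub>1\<close> and \<open>A\<^sup>* u\<^sub>i = \<theta>\<^sup>*\<^sub>i u\<^sub>i + \<phi>\<^sub>i u\<^sub>i\<^sub>-\<^sub>1\<close>.  Reading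
  \<open>\<tau>\<^sub>i(A) E\<^sup>*\<^sub>0 E\<^sub>0 \<tau>\<^sup>*\<^sub>j(A\<^sup>*)\<close> from the right: \<open>E\<^sub>0\<close> kills \<open>u\<^sub>1, \<dots>, u\<^sub>d\<close>, so only the \<open>u\<^sub>0\<close>-coordinate
  of \<open>\<tau>\<^sup>*\<^sub>j(A\<^sup>*) u\<^sub>k\<close> matters, and this is \<open>\<phi>\<^sub>1 \<cdots> \<phi>\<^sub>j\<close> for \<open>k = j\<close> and zero otherwise (\<open>E_As_tau\<close>).
  The rank-one element \<open>E\<^sup>*\<^sub>0 E\<^sub>0\<close> maps \<open>u\<^sub>0\<close> to its trace times \<open>u\<^sub>0\<close> (\<open>Es_E_0\<close>), and \<open>\<tau>\<^sub>i(A) u\<^sub>0 = u\<^sub>i\<close>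
  (\<open>A_tau\<close>).  So up to a scalar the product is the operator \<open>u\<^sub>j \<mapsto> u\<^sub>i\<close>, \<open>u\<^sub>k \<mapsto> 0\<close> for \<open>k \<noteq> j\<close>.  The
  second formula is read in the same way with \<open>u\<^sub>d\<close> in place of \<open>u\<^sub>0\<close>; there the factor of \<open>E\<^sub>d E\<^sup>*\<^sub>d\<close> on
  \<open>u\<^sub>d\<close> turns out to be the trace of \<open>E\<^sup>*\<^sub>d E\<^sub>d\<close> (\<open>E_Es_d\<close>).

  The action of \<open>A\<^sup>*\<close> on the split basis (\<open>As_u\<close>) and the nonvanishing of the \<open>\<phi>\<^sub>i\<close> and of the two
  traces are derived from the definition of a Leonard system.  All of them rest on one
  observation about an irreducible tridiagonal element: it moves the first nonzero component of a
  vector down by exactly one index, and the last one up by exactly one (\<open>step_down\<close>, \<open>step_up\<close>).\<close>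


section \<open>Modules over an algebra as vector spaces\<close>

locale algebra_module = algebra_over_field smul + left_module act
  for smul :: "'k::field \<Rightarrow> 'a::ring_1 \<Rightarrow> 'a"
    and act :: "'a \<Rightarrow> 'v::ab_group_add \<Rightarrow> 'v"
begin

abbreviation sc :: "'k \<Rightarrow> 'v \<Rightarrow> 'v" where
  "sc \<equiv> vscale smul act"

lemma act_smul: "act (smul c x) v = sc c (act x v)"
proof -
  have "smul c x = smul c 1 * x" by (simp add: smul_mult_left)
  then show ?thesis by (simp add: vscale_def act_mult)
qed

lemma act_scale: "act x (sc c v) = sc c (act x v)"
proof -
  have "x * smul c 1 = smul c x" by (simp add: smul_mult_right)
  then show ?thesis by (metis act_mult act_smul vscale_def)
qed

sublocale vs: vector_space sc
proof
  fix a b :: 'k and v w :: 'v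
  show "sc a (v + w) = sc a v + sc a w" by (simp add: vscale_def act_add_right)
  show "sc (a + b) v = sc a v + sc b v"
    by (simp add: vscale_def scale_left_distrib act_add_left)
  show "sc a (sc b v) = sc (a * b) v"
    by (simp add: vscale_def smul_mult_left flip: act_mult)
  show "sc 1 v = v" by (simp add: vscale_def act_one)
qed

lemma act_zero_right [simp]: "act x 0 = 0"
  using act_add_right[of x 0 0] by simp

lemma act_zero_left [simp]: "act 0 v = 0"
  using act_add_left[of 0 0 v] by simp

lemma act_diff_left: "act (x - y) v = act x v - act y v"
  using act_add_left[of "x - y" y v] by (simp add: algebra_simps)

lemma act_diff_right: "act x (v - w) = act x v - act x w"
  using act_add_right[of x "v - w" w] by (simp add: algebra_simps)

lemma act_sum_right: "act x (\<Sum>i\<in>I. f i) = (\<Sum>i\<in>I. act x (f i))"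
  by (induction I rule: infinite_finite_induct) (simp_all add: act_add_right)

lemma act_shift: "act (x - smul c 1) v = act x v - sc c v"
  by (simp add: act_diff_left vscale_def)

text \<open>A rank-one operator \<open>v \<mapsto> f(v) w\<close> has trace \<open>f(w)\<close> in every finite basis \<open>B\<close>: the diagonal
  entries are \<open>f(b) w\<^sub>b\<close>, and these sum to \<open>f(\<Sum>\<^sub>b w\<^sub>b b)\<close>.  The finite basis \<open>B\<^sub>0\<close> serves to see that
  the basis chosen in the definition of the trace is finite.\<close>

lemma tr_rank_one:
  assumes B0: "basis_set sc B0" "finite B0"
    and x: "\<And>v. act x v = sc (f v) w"
    and f_add: "\<And>v v'. f (v + v') = f v + f v'"
    and f_scale: "\<And>c v. f (sc c v) = c * f v"
  shows "tr smul act x = f w"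
proof -
  define B where "B = (SOME B. basis_set sc B)"
  have B: "\<not> vs.dependent B" "vs.span B = UNIV"
    using someI[of "basis_set sc", OF B0(1)] unfolding B_def[symmetric]
    by (simp_all add: basis_set_def)
  have "finite B"
    using vs.independent_span_bound[OF B0(2) B(1)] B0(1) by (simp add: basis_set_def)
  have f_sum: "f (\<Sum>b\<in>S. g b) = (\<Sum>b\<in>S. f (g b))" for S :: "'v set" and g
  proof (induction S rule: infinite_finite_induct)
    case (infinite S)
    then show ?case using f_scale[of 0 0] by simp
  next
    case empty
    then show ?case using f_scale[of 0 0] by simp
  next
    case (insert b S)
    then show ?case by (simp add: f_add)
  qed
  have "tr smul act x = (\<Sum>b\<in>B. vs.representation B (sc (f b) w) b)"
    by (simp add: tr_def Let_def B_def x)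
  also have "\<dots> = (\<Sum>b\<in>B. f (sc (vs.representation B w b) b))"
    using B by (simp add: vs.representation_scale f_scale mult.commute)
  also have "\<dots> = f w"
    unfolding f_sum[symmetric]
    using vs.sum_representation_eq[OF B(1) _ \<open>finite B\<close> order_refl, of w] B(2) by simp
  finally show ?thesis .
qed

end


section \<open>Evaluation of polynomials\<close>

context algebra_over_field
begin

lemma alg_eval_1 [simp]: "alg_eval smul 1 x = 1"
  by (simp add: alg_eval_def)

lemma alg_eval_bound:
  assumes "degree p \<le> n"
  shows "alg_eval smul p x = (\<Sum>k\<le>n. smul (coeff p k) (x ^ k))"
  unfolding alg_eval_def using assms
  by (intro sum.mono_neutral_left) (auto simp: coeff_eq_0)

lemma alg_eval_linear_factor:
  shows "alg_eval smul ([:- a, 1:] * q) x = (x - smul a 1) * alg_eval smul q x"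
    and "alg_eval smul ([:- a, 1:] * q) x = alg_eval smul q x * (x - smul a 1)"
proof -
  define n where "n = degree q"
  have deg: "degree ([:- a, 1:] * q) \<le> Suc n"
    unfolding n_def using degree_mult_le[of "[:- a, 1:]" q] by simp
  have "alg_eval smul ([:- a, 1:] * q) x
      = (\<Sum>k\<le>Suc n. smul (coeff (pCons 0 q) k) (x ^ k) - smul a (smul (coeff q k) (x ^ k)))"
    unfolding alg_eval_bound[OF deg]
    by (intro sum.cong) (simp_all add: scale_left_diff_distrib)
  also have "\<dots> = (\<Sum>k\<le>Suc n. smul (coeff (pCons 0 q) k) (x ^ k)) - smul a (alg_eval smul q x)"
    by (simp add: sum_subtractf n_def alg_eval_bound[of q "Suc (degree q)"] scale_sum_right
        scale_right_distrib del: sum.atMost_Suc)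
  also have "(\<Sum>k\<le>Suc n. smul (coeff (pCons 0 q) k) (x ^ k))
      = (\<Sum>k\<le>n. smul (coeff q k) (x ^ Suc k))"
    by (subst sum.atMost_Suc_shift) simp
  finally have *: "alg_eval smul ([:- a, 1:] * q) x
      = (\<Sum>k\<le>n. smul (coeff q k) (x ^ Suc k)) - smul a (alg_eval smul q x)" .
  show "alg_eval smul ([:- a, 1:] * q) x = (x - smul a 1) * alg_eval smul q x"
    unfolding * by (simp add: left_diff_distrib smul_mult_left)
      (simp add: alg_eval_def n_def sum_distrib_left smul_mult_right)
  show "alg_eval smul ([:- a, 1:] * q) x = alg_eval smul q x * (x - smul a 1)"
    unfolding * by (simp add: right_diff_distrib smul_mult_right)
      (simp add: alg_eval_def n_def sum_distrib_right smul_mult_left power_commutes)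
qed

lemma alg_eval_tau:
  shows "alg_eval smul (tau \<theta> 0) x = 1"
    and "alg_eval smul (tau \<theta> (Suc i)) x = (x - smul (\<theta> i) 1) * alg_eval smul (tau \<theta> i) x"
    and "alg_eval smul (tau \<theta> (Suc i)) x = alg_eval smul (tau \<theta> i) x * (x - smul (\<theta> i) 1)"
proof -
  have "tau \<theta> (Suc i) = [:- \<theta> i, 1:] * tau \<theta> i"
    by (simp add: tau_def mult.commute)
  then show
    "alg_eval smul (tau \<theta> (Suc i)) x = (x - smul (\<theta> i) 1) * alg_eval smul (tau \<theta> i) x"
    "alg_eval smul (tau \<theta> (Suc i)) x = alg_eval smul (tau \<theta> i) x * (x - smul (\<theta> i) 1)"
    using alg_eval_linear_factor by metis+
qed (simp add: tau_def)

lemma alg_eval_eta: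
  shows "alg_eval smul (eta d \<theta> 0) x = 1"
    and "alg_eval smul (eta d \<theta> (Suc i)) x
      = (x - smul (\<theta> (d - i)) 1) * alg_eval smul (eta d \<theta> i) x"
    and "alg_eval smul (eta d \<theta> (Suc i)) x
      = alg_eval smul (eta d \<theta> i) x * (x - smul (\<theta> (d - i)) 1)"
proof -
  have "eta d \<theta> i = tau (\<lambda>h. \<theta> (d - h)) i" for i
    by (simp add: eta_def tau_def)
  then show "alg_eval smul (eta d \<theta> 0) x = 1"
    "alg_eval smul (eta d \<theta> (Suc i)) x
      = (x - smul (\<theta> (d - i)) 1) * alg_eval smul (eta d \<theta> i) x"
    "alg_eval smul (eta d \<theta> (Suc i)) x
      = alg_eval smul (eta d \<theta> i) x * (x - smul (\<theta> (d - i)) 1)"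
    using alg_eval_tau[of "\<lambda>h. \<theta> (d - h)"] by metis+
qed

end


section \<open>Faithfulness\<close>

lemma unit_mat_mult_left:
  fixes M :: "'k::field mat"
  assumes M: "M \<in> carrier_mat n n" and "p < n" "i < n" "j < n"
  shows "(mat n n (\<lambda>(i, j). if i = r \<and> j = p then 1 else 0) * M) $$ (i, j)
    = (if i = r then M $$ (p, j) else 0)"
proof -
  have "(mat n n (\<lambda>(i, j). if i = r \<and> j = p then 1 else 0) * M) $$ (i, j)
      = (\<Sum>k<n. (if i = r \<and> k = p then 1 else 0) * M $$ (k, j))"
    using assms by (simp add: scalar_prod_def atLeast0LessThan)
  also have "\<dots> = (\<Sum>k<n. if k = p then if i = r then M $$ (k, j) else 0 else 0)"
    by (intro sum.cong) auto
  finally show ?thesis using assms by simp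
qed

lemma unit_mat_mult_right:
  fixes M :: "'k::field mat"
  assumes M: "M \<in> carrier_mat n n" and "q < n" "i < n" "j < n"
  shows "(M * mat n n (\<lambda>(i, j). if i = q \<and> j = s then 1 else 0)) $$ (i, j)
    = (if j = s then M $$ (i, q) else 0)"
proof -
  have "(M * mat n n (\<lambda>(i, j). if i = q \<and> j = s then 1 else 0)) $$ (i, j)
      = (\<Sum>k<n. M $$ (i, k) * (if k = q \<and> j = s then 1 else 0))"
    using assms by (simp add: scalar_prod_def atLeast0LessThan)
  also have "\<dots> = (\<Sum>k<n. if k = q then if j = s then M $$ (i, k) else 0 else 0)"
    by (intro sum.cong) auto
  finally show ?thesis using assms by simp
qed

text \<open>The annihilator of a module is a two-sided ideal.  An element with a nonzero matrix entry
  \<open>X\<^sub>p\<^sub>q\<close> generates all diagonal matrix units, because \<open>e\<^sub>r\<^sub>p X e\<^sub>q\<^sub>r = X\<^sub>p\<^sub>q e\<^sub>r\<^sub>r\<close>, and hence their sum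
  \<open>1\<close>, which annihilates no nonzero vector.\<close>

lemma (in algebra_module) matrix_algebra_faithful:
  assumes iso: "iso_matrix_algebra smul n"
    and nontrivial: "\<exists>v::'v. v \<noteq> 0"
    and ann: "\<And>v. act x v = 0"
  shows "x = 0"
proof (rule ccontr)
  assume "x \<noteq> 0"
  obtain \<psi> :: "'a \<Rightarrow> 'k mat" where bij: "bij_betw \<psi> UNIV (carrier_mat n n)"
    and \<psi>: "\<And>x y. \<psi> (x + y) = \<psi> x + \<psi> y" "\<And>x y. \<psi> (x * y) = \<psi> x * \<psi> y"
      "\<psi> 1 = 1\<^sub>m n" "\<And>c x. \<psi> (smul c x) = c \<cdot>\<^sub>m \<psi> x"
    using iso by (auto simp: iso_matrix_algebra_def)
  have inj: "\<psi> y = \<psi> z \<Longrightarrow> y = z" for y z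
    using bij by (auto simp: bij_betw_def inj_on_def)
  have carrier: "\<psi> y \<in> carrier_mat n n" for y
    using bij by (auto simp: bij_betw_def)
  have surj: "\<exists>y. \<psi> y = M" if "M \<in> carrier_mat n n" for M
    using bij that by (auto simp: bij_betw_def image_iff) (metis imageE)
  have "\<psi> 0 = 0\<^sub>m n n"
  proof -
    have "\<psi> 0 = 0 \<cdot>\<^sub>m \<psi> 0"
      using \<psi>(4)[of 0 0] by simp
    also have "\<dots> = 0\<^sub>m n n"
      using carrier[of 0] by (intro eq_matI) auto
    finally show ?thesis .
  qed
  then have "\<psi> x \<noteq> 0\<^sub>m n n"
    using inj[of x 0] \<open>x \<noteq> 0\<close> by auto
  then obtain p q where pq: "p < n" "q < n" "\<psi> x $$ (p, q) \<noteq> 0"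
    using carrier[of x] by (auto simp: mat_eq_iff)
  define e where "e r s = mat n n (\<lambda>(i, j). if i = r \<and> j = s then 1 else 0 :: 'k)" for r s
  have e_carrier: "e r s \<in> carrier_mat n n" for r s
    by (simp add: e_def)
  have diag: "\<exists>y. \<psi> y = e r r \<and> (\<forall>v. act y v = 0)" if r: "r < n" for r
  proof -
    obtain a b where ab: "\<psi> a = e r p" "\<psi> b = e q r"
      using surj e_carrier by metis
    have "e r p * \<psi> x * e q r = \<psi> x $$ (p, q) \<cdot>\<^sub>m e r r" (is "?L = ?R")
    proof (rule eq_matI)
      fix i j assume "i < dim_row ?R" "j < dim_col ?R"
      then have ij: "i < n" "j < n" by (simp_all add: e_def)
      have M: "e r p * \<psi> x \<in> carrier_mat n n"
        using e_carrier carrier by (rule mult_carrier_mat)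
      show "?L $$ (i, j) = ?R $$ (i, j)"
        using ij pq unit_mat_mult_right[OF M pq(2) ij, of r] unit_mat_mult_left[OF carrier pq(1) ij(1) pq(2), of r x]
        by (auto simp flip: e_def) (auto simp: e_def)
    qed (use carrier[of x] in \<open>auto simp: e_def\<close>)
    then have "\<psi> (smul (1 / \<psi> x $$ (p, q)) (a * x * b)) = e r r"
      using pq by (auto simp: \<psi> ab e_def intro!: eq_matI)
    moreover have "act (smul (1 / \<psi> x $$ (p, q)) (a * x * b)) v = 0" for v
      by (simp add: act_smul act_mult ann)
    ultimately show ?thesis by blast
  qed
  have "\<exists>y. \<psi> y = mat n n (\<lambda>(i, j). if i = j \<and> i < m then 1 else 0) \<and> (\<forall>v. act y v = 0)"
    if "m \<le> n" for m
    using that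
  proof (induction m)
    case 0
    have "mat n n (\<lambda>(i, j). if i = j \<and> i < 0 then 1 else 0 :: 'k) = 0\<^sub>m n n"
      by (auto intro!: eq_matI)
    then show ?case using \<open>\<psi> 0 = 0\<^sub>m n n\<close> act_zero_left by metis
  next
    case (Suc m)
    then obtain y z where y: "\<psi> y = mat n n (\<lambda>(i, j). if i = j \<and> i < m then 1 else 0)"
        "\<And>v. act y v = 0" and z: "\<psi> z = e m m" "\<And>v. act z v = 0"
      using diag[of m] by auto
    have "\<psi> (y + z) = mat n n (\<lambda>(i, j). if i = j \<and> i < Suc m then 1 else 0)"
      by (auto simp: \<psi> y z e_def intro!: eq_matI)
    moreover have "act (y + z) v = 0" for v
      by (simp add: act_add_left y z)
    ultimately show ?case by blast
  qed
  from this[of n] obtain y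
    where y: "\<psi> y = mat n n (\<lambda>(i, j). if i = j \<and> i < n then 1 else 0)" "\<And>v. act y v = 0"
    by auto
  have "\<psi> y = 1\<^sub>m n"
    unfolding y by (auto intro!: eq_matI)
  then have "y = 1" using inj \<psi>(3) by simp
  then show False using nontrivial y(2) act_one by metis
qed

section \<open>Spectral resolutions\<close>

text \<open>The action of the primitive idempotents of a multiplicity-free element, described without
  reference to their product formula.  In this form the notion is visibly invariant under reversing
  the order of the eigenvalues.\<close>

locale spectral_resolution = algebra_module smul act
  for smul :: "'k::field \<Rightarrow> 'a::ring_1 \<Rightarrow> 'a"
    and act :: "'a \<Rightarrow> 'v::ab_group_add \<Rightarrow> 'v" +
  fixes d :: nat and x :: 'a and P :: "nat \<Rightarrow> 'a" and \<theta> :: "nat \<Rightarrow> 'k"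
  assumes distinct: "inj_on \<theta> {..d}"
    and P_P: "i \<le> d \<Longrightarrow> j \<le> d \<Longrightarrow> act (P i) (act (P j) v) = (if i = j then act (P i) v else 0)"
    and P_sum: "(\<Sum>i\<le>d. act (P i) v) = v"
    and x_P: "i \<le> d \<Longrightarrow> act x (act (P i) v) = sc (\<theta> i) (act (P i) v)"
    and P_nonzero: "i \<le> d \<Longrightarrow> \<exists>v. act (P i) v \<noteq> 0"
    and P_rank_one: "i \<le> d \<Longrightarrow> \<exists>e. \<forall>v. \<exists>c. act (P i) v = sc c e"

context algebra_module
begin

lemma independent_family_spans:
  fixes e :: "nat \<Rightarrow> 'v"
  assumes B: "basis_set sc B" "finite B" "card B = d + 1"
    and indep: "\<And>c. (\<Sum>j\<le>d. sc (c j) (e j)) = 0 \<Longrightarrow> \<forall>i\<le>d. c i = 0"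
  shows "\<exists>c. v = (\<Sum>j\<le>d. sc (c j) (e j))"
proof -
  have inj: "inj_on e {..d}"
  proof (rule inj_onI, rule ccontr)
    fix i j assume ij: "i \<in> {..d}" "j \<in> {..d}" "e i = e j" "i \<noteq> j"
    define c where "c h = (if h = i then 1 else if h = j then - 1 else 0 :: 'k)" for h
    have "(\<Sum>h\<le>d. sc (c h) (e h)) = (\<Sum>h\<in>{i, j}. sc (c h) (e h))"
      using ij by (intro sum.mono_neutral_right) (auto simp: c_def)
    also have "\<dots> = 0"
      using ij by (simp add: c_def)
    finally show False
      using indep[of c] ij by (auto simp: c_def)
  qed
  have "\<not> vs.dependent (e ` {..d})"
  proof (rule vs.independent_if_scalars_zero)
    fix f w assume "(\<Sum>w\<in>e ` {..d}. sc (f w) w) = 0" "w \<in> e ` {..d}"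
    then show "f w = 0"
      using indep[of "f \<circ> e"] by (auto simp: sum.reindex[OF inj])
  qed simp
  moreover have "card (e ` {..d}) = d + 1"
    by (simp add: card_image[OF inj])
  ultimately have "v \<in> vs.span (e ` {..d})"
    using vs.independent_span_bound[OF B(2), of "insert v (e ` {..d})"] B(1,3)
      vs.independent_insert[of v "e ` {..d}"] vs.span_base[of v "e ` {..d}"]
    by (cases "v \<in> e ` {..d}") (auto simp: basis_set_def)
  then show ?thesis
    by (auto simp: vs.span_finite sum.reindex[OF inj])
qed

lemma primitive_idempotent_eigenvector:
  assumes "act x v = sc \<mu> v"
  shows "act (primitive_idempotent smul d x \<theta> i) v
    = sc (\<Prod>j\<leftarrow>filter (\<lambda>j. j \<noteq> i) [0..<d+1]. (\<mu> - \<theta> j) / (\<theta> i - \<theta> j)) v"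
proof -
  have "act (\<Prod>j\<leftarrow>js. smul (1 / (\<theta> i - \<theta> j)) (x - smul (\<theta> j) 1)) v
      = sc (\<Prod>j\<leftarrow>js. (\<mu> - \<theta> j) / (\<theta> i - \<theta> j)) v" for js
    by (induction js)
      (simp_all add: act_one act_mult act_smul act_scale act_shift assms mult.commute
        flip: vs.scale_left_diff_distrib)
  then show ?thesis
    by (simp add: primitive_idempotent_def del: upt_Suc)
qed

text \<open>A module with a basis of \<open>d + 1\<close> elements has room for only one eigenvector to each of
  \<open>d + 1\<close> eigenvalues, so these eigenvectors form a basis, and the primitive idempotents are the
  projections onto its coordinate axes.\<close>

lemma eigenvalue_sequence_resolution:
  assumes B: "basis_set sc B" "finite B" "card B = d + 1"
    and seq: "eigenvalue_sequence smul act d x P \<theta>"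
  shows "spectral_resolution smul act d x P \<theta>"
proof -
  have inj: "inj_on \<theta> {..d}" and P: "\<And>i. i \<le> d \<Longrightarrow> P i = primitive_idempotent smul d x \<theta> i"
    using seq by (auto simp: eigenvalue_sequence_def bij_betw_def)
  have "\<theta> i \<in> eigenvalues smul act x" if "i \<le> d" for i
    using seq that by (auto simp: eigenvalue_sequence_def bij_betw_def)
  then have "\<forall>i\<in>{..d}. \<exists>e. e \<noteq> 0 \<and> act x e = sc (\<theta> i) e"
    by (auto simp: eigenvalues_def eigenvalue_on_def)
  then obtain e where e: "\<And>i. i \<le> d \<Longrightarrow> e i \<noteq> 0" "\<And>i. i \<le> d \<Longrightarrow> act x (e i) = sc (\<theta> i) (e i)"
    by (metis atMost_iff)
  have P_e: "act (P i) (e j) = (if i = j then e j else 0)" if "i \<le> d" "j \<le> d" for i j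
  proof (cases "i = j")
    case True
    have one: "(\<Prod>h\<leftarrow>hs. (\<theta> j - \<theta> h) / (\<theta> j - \<theta> h)) = 1" if "\<forall>h\<in>set hs. \<theta> h \<noteq> \<theta> j" for hs
      using that by (induction hs) auto
    have "(\<Prod>h\<leftarrow>filter (\<lambda>h. h \<noteq> j) [0..<d+1]. (\<theta> j - \<theta> h) / (\<theta> j - \<theta> h)) = 1"
      by (rule one) (use that inj in \<open>auto simp: inj_on_def simp del: upt_Suc\<close>)
    then show ?thesis
      using True that by (simp add: P primitive_idempotent_eigenvector[OF e(2)] del: upt_Suc)
  next
    case False
    then have "(\<Prod>h\<leftarrow>filter (\<lambda>h. h \<noteq> i) [0..<d+1]. (\<theta> j - \<theta> h) / (\<theta> i - \<theta> h)) = 0"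
      using that by (auto simp: prod_list_zero_iff image_iff simp del: upt_Suc intro!: exI[of _ j])
    then show ?thesis
      using False that by (simp add: P primitive_idempotent_eigenvector[OF e(2)] del: upt_Suc)
  qed
  have P_comb: "act (P i) (\<Sum>j\<le>d. sc (c j) (e j)) = sc (c i) (e i)" if "i \<le> d" for i c
  proof -
    have "act (P i) (\<Sum>j\<le>d. sc (c j) (e j)) = (\<Sum>j\<le>d. if i = j then sc (c j) (e j) else 0)"
      unfolding act_sum_right using that by (intro sum.cong) (auto simp: act_scale P_e)
    then show ?thesis
      using that by simp
  qed
  have "\<forall>i\<le>d. c i = 0" if "(\<Sum>j\<le>d. sc (c j) (e j)) = 0" for c
    using P_comb[of _ c] that e(1) by auto
  then have "\<exists>c. v = (\<Sum>j\<le>d. sc (c j) (e j))" for v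
    by (rule independent_family_spans[OF B])
  then obtain c where c: "\<And>v. v = (\<Sum>j\<le>d. sc (c v j) (e j))"
    by metis
  have P_c: "act (P i) v = sc (c v i) (e i)" if "i \<le> d" for i v
    using P_comb[OF that, of "c v"] c[of v] by simp
  show ?thesis
  proof
    fix i j v assume "i \<le> d" "j \<le> d"
    then show "act (P i) (act (P j) v) = (if i = j then act (P i) v else 0)"
      by (auto simp: P_c[of j] act_scale P_e)
  next
    fix v show "(\<Sum>i\<le>d. act (P i) v) = v"
      using c[of v] by (simp add: P_c)
  next
    fix i v assume "i \<le> d"
    then show "act x (act (P i) v) = sc (\<theta> i) (act (P i) v)"
      by (simp add: P_c act_scale e mult.commute)
  next
    fix i assume "i \<le> d"
    then show "\<exists>v. act (P i) v \<noteq> 0" "\<exists>e. \<forall>v. \<exists>c. act (P i) v = sc c e"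
      using e(1) P_e P_c by metis+
  qed (rule inj)
qed

end

context spectral_resolution
begin

lemma act_resolved: "act z v = (\<Sum>j\<le>d. act z (act (P j) v))"
  using P_sum[of v] by (metis act_sum_right)

lemma P_x: "i \<le> d \<Longrightarrow> act (P i) (act x v) = sc (\<theta> i) (act (P i) v)"
proof -
  assume i: "i \<le> d"
  have "act (P i) (act x v) = (\<Sum>j\<le>d. act (P i) (act x (act (P j) v)))"
    by (simp add: act_resolved[of x v] act_sum_right)
  also have "\<dots> = (\<Sum>j\<le>d. if i = j then sc (\<theta> j) (act (P j) v) else 0)"
    using i by (intro sum.cong) (auto simp: x_P act_scale P_P)
  finally show ?thesis using i by simp
qed

lemma single_component:
  assumes "i \<le> d" "\<And>j. j \<le> d \<Longrightarrow> j \<noteq> i \<Longrightarrow> act (P j) v = 0"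
  shows "act (P i) v = v"
proof -
  have "(\<Sum>j\<le>d. act (P j) v) = (\<Sum>j\<le>d. if i = j then act (P j) v else 0)"
    using assms(2) by (intro sum.cong) auto
  then show ?thesis using assms(1) P_sum[of v] by simp
qed

text \<open>An operator that is nonzero on a line is injective on it.\<close>

lemma injective_on_range:
  assumes i: "i \<le> d" and v: "act z (act (P i) v) \<noteq> 0" and w: "act (P i) w \<noteq> 0"
  shows "act z (act (P i) w) \<noteq> 0"
proof -
  from P_rank_one[OF i] obtain e where "\<forall>v. \<exists>c. act (P i) v = sc c e" ..
  then obtain a b where "act (P i) v = sc a e" "act (P i) w = sc b e"
    by meson
  then show ?thesis using v w by (auto simp: act_scale)
qed

lemma reversed: "spectral_resolution smul act d x (\<lambda>i. P (d - i)) (\<lambda>i. \<theta> (d - i))"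
proof
  show "inj_on (\<lambda>i. \<theta> (d - i)) {..d}"
  proof (rule inj_onI)
    fix i j assume "i \<in> {..d}" "j \<in> {..d}" "\<theta> (d - i) = \<theta> (d - j)"
    then show "i = j"
      using inj_onD[OF distinct, of "d - i" "d - j"] by simp
  qed
  fix v show "(\<Sum>i\<le>d. act (P (d - i)) v) = v"
    using P_sum[of v] sum.nat_diff_reindex[of "\<lambda>i. act (P i) v" "Suc d"]
    by (simp add: lessThan_Suc_atMost)
next
  fix i j v assume "i \<le> d" "j \<le> d"
  then show "act (P (d - i)) (act (P (d - j)) v) = (if i = j then act (P (d - i)) v else 0)"
    by (auto simp: P_P)
qed (simp_all add: x_P P_nonzero P_rank_one)

end


section \<open>Irreducible tridiagonal elements\<close>

definition irreducible_tridiagonal :: "nat \<Rightarrow> (nat \<Rightarrow> 'a::ring_1) \<Rightarrow> 'a \<Rightarrow> bool" where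
  "irreducible_tridiagonal d P y \<longleftrightarrow>
     (\<forall>i\<le>d. \<forall>j\<le>d.
        (\<bar>int i - int j\<bar> > 1 \<longrightarrow> P i * y * P j = 0) \<and>
        (\<bar>int i - int j\<bar> = 1 \<longrightarrow> P i * y * P j \<noteq> 0))"

lemma irreducible_tridiagonal_reversed:
  assumes "irreducible_tridiagonal d P y"
  shows "irreducible_tridiagonal d (\<lambda>i. P (d - i)) y"
  unfolding irreducible_tridiagonal_def
proof (intro allI impI)
  fix i j assume ij: "i \<le> d" "j \<le> d"
  then have "\<bar>int (d - i) - int (d - j)\<bar> = \<bar>int i - int j\<bar>" by auto
  then show "(\<bar>int i - int j\<bar> > 1 \<longrightarrow> P (d - i) * y * P (d - j) = 0) \<and>
      (\<bar>int i - int j\<bar> = 1 \<longrightarrow> P (d - i) * y * P (d - j) \<noteq> 0)"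
    using assms diff_le_self[of d i] diff_le_self[of d j]
    unfolding irreducible_tridiagonal_def by metis
qed

locale tridiagonal_resolution = spectral_resolution smul act d x P \<theta>
  for smul :: "'k::field \<Rightarrow> 'a::ring_1 \<Rightarrow> 'a"
    and act :: "'a \<Rightarrow> 'v::ab_group_add \<Rightarrow> 'v"
    and d x P \<theta> +
  fixes y :: 'a
  assumes faithful: "(\<And>v. act z v = 0) \<Longrightarrow> z = 0"
    and tridiagonal: "irreducible_tridiagonal d P y"
begin

lemma reversed_tridiagonal:
  "tridiagonal_resolution smul act d x (\<lambda>i. P (d - i)) (\<lambda>i. \<theta> (d - i)) y"
  using reversed irreducible_tridiagonal_reversed[OF tridiagonal] faithful
  by (simp add: tridiagonal_resolution_def tridiagonal_resolution_axioms_def)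

lemma tridiagonal_zero:
  assumes "k \<le> d" "\<And>j. j \<le> d \<Longrightarrow> j \<le> Suc k \<Longrightarrow> act (P j) v = 0"
  shows "act (P k) (act y v) = 0"
proof -
  have "act (P k * y) (act (P j) v) = 0" if j: "j \<le> d" for j
  proof (cases "j \<le> Suc k")
    case True
    then show ?thesis using assms(2)[OF j] by simp
  next
    case False
    then have "P k * y * P j = 0"
      using tridiagonal assms(1) j by (simp add: irreducible_tridiagonal_def)
    then show ?thesis by (metis act_mult act_zero_left)
  qed
  then have "act (P k * y) v = 0"
    by (subst act_resolved) simp
  then show ?thesis by (simp add: act_mult)
qed

text \<open>If \<open>k + 1\<close> is the index of the first nonzero component of \<open>v\<close>, then \<open>y\<close> moves this component,
  and nothing else, to index \<open>k\<close>.  This is where irreducibility is used.\<close>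

lemma step_down:
  assumes k: "k < d" and zero: "\<And>j. j \<le> k \<Longrightarrow> act (P j) v = 0"
    and nz: "act (P (Suc k)) v \<noteq> 0"
  shows "act (P k) (act y v) \<noteq> 0"
proof -
  have "P k * y * P (Suc k) \<noteq> 0"
    using tridiagonal k by (simp add: irreducible_tridiagonal_def)
  then obtain v0 where "act (P k * y) (act (P (Suc k)) v0) \<noteq> 0"
    using faithful by (metis act_mult)
  then have nz': "act (P k * y) (act (P (Suc k)) v) \<noteq> 0"
    using injective_on_range[of "Suc k"] k nz by auto
  \<comment> \<open>Without its component at \<open>k + 1\<close>, \<open>v\<close> is out of reach of index \<open>k\<close>.\<close>
  have "act (P k) (act y (v - act (P (Suc k)) v)) = 0"
    using k zero by (intro tridiagonal_zero) (auto simp: act_diff_right P_P)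
  then show ?thesis
    using nz' by (simp add: act_diff_right act_mult)
qed

lemma step_up:
  assumes k: "k < d" and zero: "\<And>j. j \<le> d \<Longrightarrow> k < j \<Longrightarrow> act (P j) v = 0"
    and nz: "act (P k) v \<noteq> 0"
  shows "act (P (Suc k)) (act y v) \<noteq> 0"
proof -
  interpret R: tridiagonal_resolution smul act d x "\<lambda>i. P (d - i)" "\<lambda>i. \<theta> (d - i)" y
    by (rule reversed_tridiagonal)
  show ?thesis
    using R.step_down[of "d - Suc k" v] k zero nz by (simp add: Suc_diff_Suc)
qed

text \<open>For an eigenvector \<open>v\<close> of \<open>y\<close>, \<open>y v\<close> has no component where \<open>v\<close> has none, so \<open>v\<close> cannot have a
  first nonzero component at a positive index, from which \<open>y\<close> would step down.\<close>

lemma first_component_nonzero: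
  assumes v: "act y v = sc \<mu> v" "v \<noteq> 0"
  shows "act (P 0) v \<noteq> 0"
proof
  assume "act (P 0) v = 0"
  have "act (P k) v = 0" if "k \<le> d" for k
    using that
  proof (induction k rule: less_induct)
    case (less k)
    show ?case
    proof (cases k)
      case 0
      then show ?thesis using \<open>act (P 0) v = 0\<close> by simp
    next
      case (Suc m)
      then have "act (P m) (act y v) = 0"
        using less by (simp add: v act_scale)
      then show ?thesis
        using step_down[of m v] Suc less by auto
    qed
  qed
  then show False using P_sum[of v] v(2) by simp
qed

lemma last_component_nonzero:
  assumes "act y v = sc \<mu> v" "v \<noteq> 0"
  shows "act (P d) v \<noteq> 0"
proof -
  interpret R: tridiagonal_resolution smul act d x "\<lambda>i. P (d - i)" "\<lambda>i. \<theta> (d - i)" y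
    by (rule reversed_tridiagonal)
  show ?thesis using R.first_component_nonzero[OF assms] by simp
qed

end

section \<open>The split basis\<close>

locale split_leonard_system = algebra_module smul act
  + E: tridiagonal_resolution smul act d A E \<theta> As
  + Es: tridiagonal_resolution smul act d As Es \<theta>s A
  for smul :: "'k::field \<Rightarrow> 'a::ring_1 \<Rightarrow> 'a"
    and act :: "'a \<Rightarrow> 'v::ab_group_add \<Rightarrow> 'v"
    and d A E \<theta> As Es \<theta>s +
  fixes u :: "nat \<Rightarrow> 'v" and \<phi> :: "nat \<Rightarrow> 'k"
  assumes split: "split_basis smul act d A E Es \<theta> u"
    and first_split: "first_split_sequence smul act d A E As Es \<theta> \<theta>s \<phi>"
begin

lemma basis: "basis_set sc (u ` {..d})" and u_inj: "inj_on u {..d}"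
  and u_nonzero: "i \<le> d \<Longrightarrow> u i \<noteq> 0" and u_split: "i \<le> d \<Longrightarrow> u i \<in> split_space act d E Es i"
  and A_u: "i < d \<Longrightarrow> act (A - smul (\<theta> i) 1) (u i) = u (Suc i)"
  using split by (auto simp: split_basis_def)

definition co :: "nat \<Rightarrow> 'v \<Rightarrow> 'k" where
  "co k v = vs.representation (u ` {..d}) v (u k)"

lemma co_add: "co k (v + w) = co k v + co k w"
  and co_scale: "co k (sc c v) = c * co k v"
  and co_zero: "co k 0 = 0"
  using basis by (simp_all add: co_def basis_set_def vs.representation_add
      vs.representation_scale vs.representation_zero)

lemma co_u: "i \<le> d \<Longrightarrow> k \<le> d \<Longrightarrow> co k (u i) = (if k = i then 1 else 0)"
  using basis u_inj by (auto simp: co_def basis_set_def vs.representation_basis inj_on_def)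

lemma expansion: "v = (\<Sum>k\<le>d. sc (co k v) (u k))"
  using vs.sum_representation_eq[of "u ` {..d}" v "u ` {..d}"] basis u_inj
  by (simp add: basis_set_def sum.reindex co_def)

lemma act_expansion: "act x v = (\<Sum>k\<le>d. sc (co k v) (act x (u k)))"
  by (subst expansion) (simp add: act_sum_right act_scale)

lemma E_split_zero:
  assumes "v \<in> split_space act d E Es i" "i \<le> d" "k < i"
  shows "act (E k) v = 0"
proof -
  obtain w where "v = (\<Sum>h\<in>{i..d}. act (E h) (w h))"
    using assms by (auto simp: split_space_def)
  then show ?thesis using assms by (simp add: act_sum_right E.P_P)
qed

lemma Es_split_zero:
  assumes "v \<in> split_space act d E Es i" "i < k" "k \<le> d"
  shows "act (Es k) v = 0"
proof -
  obtain w where "v = (\<Sum>h\<in>{0..i}. act (Es h) (w h))"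
    using assms by (auto simp: split_space_def)
  then show ?thesis using assms by (simp add: act_sum_right Es.P_P)
qed

lemma E_u_zero: "k < i \<Longrightarrow> i \<le> d \<Longrightarrow> act (E k) (u i) = 0"
  using E_split_zero[OF u_split] by simp

lemma Es_u_zero: "i < k \<Longrightarrow> k \<le> d \<Longrightarrow> act (Es k) (u i) = 0"
  using Es_split_zero[OF u_split] by simp

lemma A_u_last: "act (A - smul (\<theta> d) 1) (u d) = 0"
proof -
  have "act (E d) (u d) = u d"
    by (rule E.single_component) (auto simp: E_u_zero)
  then show ?thesis using E.x_P[of d "u d"] by (simp add: act_shift)
qed

text \<open>Since \<open>u\<^sub>j = \<tau>\<^sub>j(A) u\<^sub>0\<close>, \<open>E\<^sub>k u\<^sub>j = \<tau>\<^sub>j(\<theta>\<^sub>k) E\<^sub>k u\<^sub>0\<close>.  So \<open>E\<^sub>k u\<^sub>0 = 0\<close> would make \<open>E\<^sub>k\<close> vanish on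
  the whole basis, and the factor \<open>\<tau>\<^sub>j(\<theta>\<^sub>k)\<close> vanishes only for \<open>j > k\<close>.\<close>

lemma E_u_nonzero: "j \<le> k \<Longrightarrow> k \<le> d \<Longrightarrow> act (E k) (u j) \<noteq> 0"
proof -
  have step: "act (E k) (u (Suc j)) = sc (\<theta> k - \<theta> j) (act (E k) (u j))" if "k \<le> d" "j < d" for k j
    using that by (simp add: act_shift act_diff_right act_scale E.P_x vs.scale_left_diff_distrib
        flip: A_u)
  have zeroth: "act (E k) (u 0) \<noteq> 0" if k: "k \<le> d" for k
  proof
    assume zero: "act (E k) (u 0) = 0"
    have "act (E k) (u j) = 0" if "j \<le> d" for j
      using that by (induction j) (simp_all add: zero step k)
    then have "act (E k) v = 0" for v
      by (subst act_expansion) simp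
    then show False using E.P_nonzero[OF k] by simp
  qed
  show "j \<le> k \<Longrightarrow> k \<le> d \<Longrightarrow> act (E k) (u j) \<noteq> 0"
  proof (induction j)
    case (Suc j)
    then have "\<theta> k \<noteq> \<theta> j"
      using inj_onD[OF E.distinct, of k j] by auto
    then show ?case using Suc by (simp add: step)
  qed (rule zeroth)
qed

text \<open>\<open>u\<^sub>k\<close> has no component beyond the \<open>k\<close>-th eigenspace of \<open>A\<^sup>*\<close>, and the irreducible tridiagonal
  \<open>A\<close> carries the component there to index \<open>k + 1\<close> when it maps \<open>u\<^sub>k\<close> to \<open>u\<^sub>k\<^sub>+\<^sub>1\<close> (up to a multiple
  of \<open>u\<^sub>k\<close>).\<close>

lemma Es_u_diagonal_nonzero: "k \<le> d \<Longrightarrow> act (Es k) (u k) \<noteq> 0"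
proof (induction k)
  case 0
  have "act (Es 0) (u 0) = u 0"
    by (rule Es.single_component) (auto simp: Es_u_zero)
  then show ?case using u_nonzero by simp
next
  case (Suc k)
  then have "act (Es (Suc k)) (act A (u k)) \<noteq> 0"
    by (intro Es.step_up) (auto simp: Es_u_zero)
  then show ?case
    using Suc.prems by (simp add: act_shift act_diff_right act_scale Es_u_zero flip: A_u)
qed

text \<open>The matrices with columns \<open>E\<^sub>k u\<^sub>j\<close> and \<open>E\<^sup>*\<^sub>k u\<^sub>j\<close> are triangular with nonzero diagonal, so
  the vanishing of components in the eigenspaces of \<open>A\<close> or \<open>A\<^sup>*\<close> forces the vanishing of coordinates in
  the split basis.\<close>

lemma co_zero_below:
  assumes zero: "\<And>k. k < i \<Longrightarrow> act (E k) v = 0" and "i \<le> d"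
  shows "m < i \<Longrightarrow> co m v = 0"
proof (induction m rule: less_induct)
  case (less m)
  have "0 = (\<Sum>k\<le>d. sc (co k v) (act (E m) (u k)))"
    using zero[of m] less by (simp flip: act_expansion)
  also have "\<dots> = (\<Sum>k\<le>d. if k = m then sc (co k v) (act (E m) (u k)) else 0)"
    using less \<open>i \<le> d\<close> E_u_zero by (intro sum.cong) (auto simp: nat_neq_iff)
  finally show ?case
    using E_u_nonzero[of m m] less \<open>i \<le> d\<close> by simp
qed

lemma co_zero_above:
  assumes zero: "\<And>k. i \<le> k \<Longrightarrow> k \<le> d \<Longrightarrow> act (Es k) v = 0"
  shows "i \<le> m \<Longrightarrow> m \<le> d \<Longrightarrow> co m v = 0"
proof (induction "d - m" arbitrary: m rule: less_induct)
  case less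
  have above: "co k v = 0" if "m < k" "k \<le> d" for k
    using less.hyps[of k] that less.prems by simp
  have "0 = (\<Sum>k\<le>d. sc (co k v) (act (Es m) (u k)))"
    using zero[of m] less.prems by (simp flip: act_expansion)
  also have "\<dots> = (\<Sum>k\<le>d. if k = m then sc (co k v) (act (Es m) (u k)) else 0)"
    using less.prems above Es_u_zero by (intro sum.cong) (auto simp: nat_neq_iff)
  finally show ?case
    using Es_u_diagonal_nonzero[of m] less.prems by simp
qed

lemma single_coordinate:
  assumes "i \<le> d" "\<And>k. k < i \<Longrightarrow> act (E k) v = 0"
    "\<And>k. i < k \<Longrightarrow> k \<le> d \<Longrightarrow> act (Es k) v = 0"
  shows "v = sc (co i v) (u i)"
proof -
  have "co m v = 0" if "m \<le> d" "m \<noteq> i" for m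
    using co_zero_below[of i v m] co_zero_above[of "Suc i" v m] assms that by (cases "m < i") auto
  then have "(\<Sum>k\<le>d. sc (co k v) (u k)) = (\<Sum>k\<le>d. if k = i then sc (co k v) (u k) else 0)"
    by (intro sum.cong) auto
  then show ?thesis using assms(1) expansion[of v] by simp
qed

lemma As_u_0: "act (As - smul (\<theta>s 0) 1) (u 0) = 0"
proof -
  have "act (Es 0) (u 0) = u 0"
    by (rule Es.single_component) (auto simp: Es_u_zero)
  then show ?thesis using Es.x_P[of 0 "u 0"] by (simp add: act_shift)
qed

text \<open>\<open>(A\<^sup>* - \<theta>\<^sup>*\<^sub>i) u\<^sub>i\<close> loses its component in the \<open>i\<close>-th eigenspace of \<open>A\<^sup>*\<close>, and in the eigenspaces of
  \<open>A\<close> it reaches down by one index only; hence it is a multiple of \<open>u\<^sub>i\<^sub>-\<^sub>1\<close>.  As \<open>A - \<theta>\<^sub>i\<^sub>-\<^sub>1\<close> brings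
  \<open>u\<^sub>i\<^sub>-\<^sub>1\<close> back to \<open>u\<^sub>i\<close>, the multiple is \<open>\<phi>\<^sub>i\<close>.\<close>

lemma As_u:
  assumes i: "i < d"
  shows "act (As - smul (\<theta>s (Suc i)) 1) (u (Suc i)) = sc (\<phi> (Suc i)) (u i)"
proof -
  define w where "w = act (As - smul (\<theta>s (Suc i)) 1) (u (Suc i))"
  have "act (Es k) w = 0" if "i < k" "k \<le> d" for k
    using that Es_u_zero[of "Suc i" k]
    by (cases "k = Suc i") (auto simp: w_def act_shift act_diff_right act_scale Es.P_x)
  moreover have "act (E k) w = 0" if "k < i" for k
    using that i E_u_zero[of k "Suc i"] E.tridiagonal_zero[of k "u (Suc i)"]
    by (auto simp: w_def act_shift act_diff_right act_scale E_u_zero)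
  ultimately have w: "w = sc (co i w) (u i)"
    using i by (intro single_coordinate) auto
  obtain v where v: "v \<in> split_space act d E Es (Suc i)" "v \<noteq> 0"
    "act ((A - smul (\<theta> i) 1) * (As - smul (\<theta>s (Suc i)) 1)) v = sc (\<phi> (Suc i)) v"
    using first_split i unfolding first_split_sequence_def eigenvalue_on_def
    by (metis Suc_leI atLeastAtMost_iff diff_Suc_1 le_add1 plus_1_eq_Suc)
  define t where "t = co (Suc i) v"
  have vt: "v = sc t (u (Suc i))"
    unfolding t_def using i v(1) E_split_zero Es_split_zero by (intro single_coordinate) auto
  have "sc (\<phi> (Suc i)) v = sc t (act (A - smul (\<theta> i) 1) w)"
    using v(3) by (simp add: vt act_mult act_scale w_def)
  also have "\<dots> = sc t (sc (co i w) (u (Suc i)))"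
    by (subst w) (simp add: act_scale A_u i)
  also have "\<dots> = sc (co i w) v"
    by (simp add: vt mult.commute)
  finally have "\<phi> (Suc i) = co i w"
    using v(2) by simp
  then show ?thesis using w w_def by simp
qed

text \<open>Otherwise \<open>u\<^sub>i\<close> would be an eigenvector of \<open>A\<^sup>*\<close>; but its first nonzero component with respect
  to \<open>A\<close> has index \<open>i\<close>, and \<open>A\<^sup>*\<close> moves that component down to index \<open>i - 1\<close>.\<close>

lemma phi_nonzero:
  assumes "i \<in> {1..d}"
  shows "\<phi> i \<noteq> 0"
proof
  assume "\<phi> i = 0"
  obtain m where i: "i = Suc m" and m: "m < d"
    using assms by (cases i) auto
  have "act As (u i) = sc (\<theta>s i) (u i)"
    using As_u[OF m] \<open>\<phi> i = 0\<close> by (simp add: act_shift i)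
  then have "act (E m) (act As (u i)) = 0"
    using E_u_zero[of m i] assms i by (simp add: act_scale)
  moreover have "act (E m) (act As (u i)) \<noteq> 0"
    unfolding i using m by (intro E.step_down) (auto simp: E_u_zero E_u_nonzero)
  ultimately show False by simp
qed


section \<open>The four polynomials on the split basis\<close>

text \<open>The product \<open>\<tau>\<^sup>*\<^sub>j(A\<^sup>*)\<close> has \<open>j\<close> factors, each of which lowers the index by at most one, so \<open>u\<^sub>k\<close>
  with \<open>k > j\<close> does not reach \<open>u\<^sub>0\<close>, the only basis vector that survives \<open>E\<^sub>0\<close>; for \<open>k = j\<close> every factor
  must lower it; for \<open>k < j\<close> the product kills \<open>u\<^sub>k\<close>.  In the induction, the factor \<open>A\<^sup>* - \<theta>\<^sup>*\<^sub>j\<close> is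
  applied first, and the term \<open>(\<theta>\<^sup>*\<^sub>k - \<theta>\<^sup>*\<^sub>j) u\<^sub>k\<close> contributes nothing: for \<open>k \<noteq> j\<close> by the induction
  hypothesis, for \<open>k = j\<close> because of its coefficient.\<close>

lemma E_As_tau:
  assumes "j \<le> d" "k \<le> d"
  shows "act (E 0 * alg_eval smul (tau \<theta>s j) As) (u k)
    = (if k = j then sc (\<Prod>h\<in>{1..j}. \<phi> h) (act (E 0) (u 0)) else 0)"
  using assms
proof (induction j arbitrary: k)
  case 0
  then show ?case by (auto simp: alg_eval_tau E_u_zero)
next
  case (Suc j)
  let ?X = "E 0 * alg_eval smul (tau \<theta>s j) As"
  have "act (E 0 * alg_eval smul (tau \<theta>s (Suc j)) As) (u k)
      = act ?X (act (As - smul (\<theta>s j) 1) (u k))"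
    by (simp add: alg_eval_tau(3) act_mult)
  also have "act (As - smul (\<theta>s j) 1) (u k)
      = sc (\<theta>s k - \<theta>s j) (u k) + act (As - smul (\<theta>s k) 1) (u k)"
    by (simp add: act_shift vs.scale_left_diff_distrib)
  also have "act ?X \<dots> = act ?X (act (As - smul (\<theta>s k) 1) (u k))"
    using Suc by (simp add: act_add_right act_scale)
  also have "\<dots> = (if k = Suc j then sc (\<Prod>h\<in>{1..Suc j}. \<phi> h) (act (E 0) (u 0)) else 0)"
  proof (cases k)
    case 0
    then show ?thesis by (simp add: As_u_0)
  next
    case k: (Suc m)
    then show ?thesis using Suc by (simp add: As_u act_scale mult.commute)
  qed
  finally show ?case .
qed

text \<open>The same argument upwards: \<open>A\<close> raises the index, \<open>u\<^sub>d\<close> is the only basis vector that survives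
  \<open>E\<^sup>*\<^sub>d\<close>, and each raising step has coefficient \<open>1\<close>.\<close>

lemma Es_A_eta:
  assumes "m \<le> d" "k \<le> d"
  shows "act (Es d * alg_eval smul (eta d \<theta> m) A) (u k)
    = (if k = d - m then act (Es d) (u d) else 0)"
  using assms
proof (induction m arbitrary: k)
  case 0
  then show ?case by (auto simp: alg_eval_eta Es_u_zero)
next
  case (Suc m)
  let ?X = "Es d * alg_eval smul (eta d \<theta> m) A"
  have "act (Es d * alg_eval smul (eta d \<theta> (Suc m)) A) (u k)
      = act ?X (act (A - smul (\<theta> (d - m)) 1) (u k))"
    by (simp add: alg_eval_eta(3) act_mult)
  also have "act (A - smul (\<theta> (d - m)) 1) (u k)
      = sc (\<theta> k - \<theta> (d - m)) (u k) + act (A - smul (\<theta> k) 1) (u k)"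
    by (simp add: act_shift vs.scale_left_diff_distrib)
  also have "act ?X \<dots> = act ?X (act (A - smul (\<theta> k) 1) (u k))"
    using Suc by (simp add: act_add_right act_scale)
  also have "\<dots> = (if k = d - Suc m then act (Es d) (u d) else 0)"
  proof (cases "k = d")
    case True
    then show ?thesis using Suc.prems by (auto simp: A_u_last)
  next
    case False
    then show ?thesis using Suc by (auto simp: A_u)
  qed
  finally show ?case .
qed

lemma A_tau: "i \<le> d \<Longrightarrow> act (alg_eval smul (tau \<theta> i) A) (u 0) = u i"
  by (induction i) (simp_all add: alg_eval_tau(1,2) act_one act_mult A_u)

lemma As_eta:
  "i \<le> d \<Longrightarrow> act (alg_eval smul (eta d \<theta>s (d - i)) As) (u d) = sc (\<Prod>h\<in>{i+1..d}. \<phi> h) (u i)"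
proof (induction "d - i" arbitrary: i)
  case 0
  then show ?case by (simp add: alg_eval_eta act_one)
next
  case (Suc m)
  then have i: "i < d" and m: "m = d - Suc i" by auto
  have "act (alg_eval smul (eta d \<theta>s (Suc (d - Suc i))) As) (u d)
      = act (As - smul (\<theta>s (Suc i)) 1) (sc (\<Prod>h\<in>{Suc i+1..d}. \<phi> h) (u (Suc i)))"
    using i Suc.hyps(1)[OF m] by (simp add: alg_eval_eta(2) act_mult)
  also have "\<dots> = sc (\<Prod>h\<in>{i+1..d}. \<phi> h) (u i)"
    using i prod.atLeast_Suc_atMost[of "Suc i" d \<phi>] by (simp add: As_u act_scale mult.commute)
  finally show ?case using i by (simp add: Suc_diff_Suc)
qed


section \<open>The two traces\<close>

text \<open>\<open>E\<^sub>0\<close> annihilates \<open>u\<^sub>1, \<dots>, u\<^sub>d\<close> and \<open>E\<^sup>*\<^sub>0\<close> projects onto the line of \<open>u\<^sub>0\<close>, so \<open>E\<^sup>*\<^sub>0 E\<^sub>0\<close> has rank one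
  and its trace is its factor on \<open>u\<^sub>0\<close>.\<close>

lemma Es_E_0: "act (Es 0 * E 0) (u 0) = sc (tr smul act (Es 0 * E 0)) (u 0)"
proof -
  define w where "w = act (Es 0 * E 0) (u 0)"
  have w: "w = sc (co 0 w) (u 0)"
    by (rule single_coordinate) (auto simp: w_def act_mult Es.P_P)
  have "act (Es 0 * E 0) v = sc (co 0 v) w" for v
  proof -
    have "act (Es 0 * E 0) v
        = (\<Sum>k\<le>d. if k = 0 then sc (co k v) (act (Es 0 * E 0) (u k)) else 0)"
      by (subst act_expansion, intro sum.cong) (auto simp: act_mult E_u_zero)
    then show ?thesis by (simp add: w_def)
  qed
  then have "tr smul act (Es 0 * E 0) = co 0 w"
    by (intro tr_rank_one[OF basis]) (auto simp: co_add co_scale)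
  then show ?thesis using w w_def by simp
qed

text \<open>\<open>E\<^sub>d\<close> has image \<open>\<bbbK> u\<^sub>d\<close>, say \<open>E\<^sub>d v = a(v) u\<^sub>d\<close>.  Then \<open>E\<^sup>*\<^sub>d E\<^sub>d v = a(v) E\<^sup>*\<^sub>d u\<^sub>d\<close> has trace
  \<open>a(E\<^sup>*\<^sub>d u\<^sub>d)\<close>, which is also the factor of \<open>E\<^sub>d E\<^sup>*\<^sub>d\<close> on \<open>u\<^sub>d\<close>.\<close>

lemma E_Es_d: "act (E d * Es d) (u d) = sc (tr smul act (Es d * E d)) (u d)"
proof -
  define a where "a v = co d (act (E d) v)" for v
  have a: "act (E d) v = sc (a v) (u d)" for v
    unfolding a_def by (rule single_coordinate) (auto simp: E.P_P)
  have "tr smul act (Es d * E d) = a (act (Es d) (u d))"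
    by (rule tr_rank_one[OF basis])
      (auto simp: act_mult a act_scale, auto simp: a_def act_add_right co_add act_scale co_scale)
  then show ?thesis by (simp add: act_mult a)
qed

text \<open>An eigenvector of \<open>A\<close> has a nonzero component in the first eigenspace of \<open>A\<^sup>*\<close>, and an
  eigenvector of \<open>A\<^sup>*\<close> in the last eigenspace of \<open>A\<close>.\<close>

lemma trace_0_nonzero: "tr smul act (Es 0 * E 0) \<noteq> 0"
proof -
  have "act (Es 0) (act (E 0) (u 0)) \<noteq> 0"
    using Es.first_component_nonzero[OF E.x_P] E_u_nonzero by blast
  then show ?thesis using Es_E_0 by (auto simp: act_mult)
qed

lemma trace_d_nonzero: "tr smul act (Es d * E d) \<noteq> 0"
proof -
  have "act (E d) (act (Es d) (u d)) \<noteq> 0"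
    using E.last_component_nonzero[OF Es.x_P] Es_u_diagonal_nonzero by blast
  then show ?thesis using E_Es_d by (auto simp: act_mult)
qed


section \<open>Matrix units\<close>

lemma eq_on_basis:
  assumes "\<And>k. k \<le> d \<Longrightarrow> act x (u k) = act y (u k)"
  shows "x = y"
proof -
  have "act x v = act y v" for v
    using assms by (simp add: act_expansion[of _ v])
  then have "x - y = 0"
    by (intro E.faithful) (simp add: act_diff_left)
  then show ?thesis by simp
qed

text \<open>By faithfulness an element is determined by its matrix, so an element acting as a matrix unit
  is the one singled out by the definite description.\<close>

lemma matrix_unit_eqI:
  assumes i: "i \<le> d" and x: "\<And>k. k \<le> d \<Longrightarrow> act x (u k) = (if k = j then u i else 0)"
  shows "matrix_unit smul act d u i j = x"
  unfolding matrix_unit_def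
proof (rule the_equality)
  show x_mat: "natural_matrix smul act d u x
      = mat (d+1) (d+1) (\<lambda>(r, c). if r = i \<and> c = j then 1 else 0)"
    using i by (auto simp: natural_matrix_def x co_u co_zero simp flip: co_def intro!: eq_matI)
  fix y assume "natural_matrix smul act d u y
      = mat (d+1) (d+1) (\<lambda>(r, c). if r = i \<and> c = j then 1 else 0)"
  then have eq: "natural_matrix smul act d u y = natural_matrix smul act d u x"
    using x_mat by simp
  have "co r (act y (u c)) = co r (act x (u c))" if "r \<le> d" "c \<le> d" for r c
    using arg_cong[OF eq, of "\<lambda>M. M $$ (r, c)"] that by (simp add: natural_matrix_def co_def)
  then have "act y (u c) = act x (u c)" if "c \<le> d" for c
    using that expansion[of "act y (u c)"] expansion[of "act x (u c)"] by simp
  then show "y = x" by (rule eq_on_basis)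
qed

lemma matrix_unit_via_E0:
  assumes "i \<le> d" "j \<le> d"
  shows "matrix_unit smul act d u i j
    = smul (inverse (tr smul act (Es 0 * E 0)) / (\<Prod>h\<in>{1..j}. \<phi> h))
        (alg_eval smul (tau \<theta> i) A * Es 0 * E 0 * alg_eval smul (tau \<theta>s j) As)"
proof (rule matrix_unit_eqI[OF assms(1)])
  fix k assume k: "k \<le> d"
  have "(\<Prod>h\<in>{1..j}. \<phi> h) \<noteq> 0"
    using phi_nonzero assms by auto
  then show "act (smul (inverse (tr smul act (Es 0 * E 0)) / (\<Prod>h\<in>{1..j}. \<phi> h))
        (alg_eval smul (tau \<theta> i) A * Es 0 * E 0 * alg_eval smul (tau \<theta>s j) As)) (u k)
      = (if k = j then u i else 0)"
    using assms k E_As_tau[of j k] Es_E_0 trace_0_nonzero A_tau[of i]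
    by (auto simp: act_smul act_mult act_scale)
qed

lemma matrix_unit_via_Ed:
  assumes "i \<le> d" "j \<le> d"
  shows "matrix_unit smul act d u i j
    = smul (inverse (tr smul act (Es d * E d)) / (\<Prod>h\<in>{i+1..d}. \<phi> h))
        (alg_eval smul (eta d \<theta>s (d - i)) As * E d * Es d * alg_eval smul (eta d \<theta> (d - j)) A)"
proof (rule matrix_unit_eqI[OF assms(1)])
  fix k assume k: "k \<le> d"
  have "(\<Prod>h\<in>{i+1..d}. \<phi> h) \<noteq> 0"
    using phi_nonzero by auto
  then show "act (smul (inverse (tr smul act (Es d * E d)) / (\<Prod>h\<in>{i+1..d}. \<phi> h))
        (alg_eval smul (eta d \<theta>s (d - i)) As * E d * Es d * alg_eval smul (eta d \<theta> (d - j)) A)) (u k)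
      = (if k = j then u i else 0)"
    using assms k Es_A_eta[of "d - j" k] E_Es_d trace_d_nonzero As_eta[of i]
    by (auto simp: act_smul act_mult act_scale)
qed

end


section \<open>The matrix units of a Leonard system\<close>

theorem theorem6p5:
  fixes smul :: "'k::field \<Rightarrow> 'a::ring_1 \<Rightarrow> 'a"
    and act :: "'a \<Rightarrow> 'v::ab_group_add \<Rightarrow> 'v"
    and d :: nat
    and A As :: 'a
    and E Es :: "nat \<Rightarrow> 'a"
    and \<theta> \<theta>s \<phi> :: "nat \<Rightarrow> 'k"
    and u :: "nat \<Rightarrow> 'v"
    and \<Delta> :: "nat \<Rightarrow> nat \<Rightarrow> 'a"
    and \<nu> \<nu>dd :: 'k
  assumes "algebra_over_field smul"
    and "iso_matrix_algebra smul (d + 1)"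
    and "simple_module act"
    and "leonard_system smul act d A E As Es"
    and "eigenvalue_sequence smul act d A E \<theta>"
    and "eigenvalue_sequence smul act d As Es \<theta>s"
    and "first_split_sequence smul act d A E As Es \<theta> \<theta>s \<phi>"
    and "split_basis smul act d A E Es \<theta> u"
  defines "\<Delta> \<equiv> matrix_unit smul act d u"
    and "\<nu> \<equiv> inverse (tr smul act (Es 0 * E 0))"
    and "\<nu>dd \<equiv> inverse (tr smul act (Es d * E d))"
  shows "\<forall>i\<le>d. \<forall>j\<le>d.
      \<Delta> i j = smul (\<nu> / (\<Prod>h\<in>{1..j}. \<phi> h))
                 (alg_eval smul (tau \<theta> i) A * Es 0 * E 0 * alg_eval smul (tau \<theta>s j) As) \<and>
      \<Delta> i j = smul (\<nu>dd / (\<Prod>h\<in>{i+1..d}. \<phi> h))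
                 (alg_eval smul (eta d \<theta>s (d - i)) As * E d * Es d * alg_eval smul (eta d \<theta> (d - j)) A)"
proof -
  interpret algebra_over_field smul by fact
  interpret simple_module act by fact
  interpret algebra_module smul act ..
  have faithful: "z = 0" if "\<And>v. act z v = 0" for z
    using matrix_algebra_faithful[OF assms(2) nontrivial that] .
  have basis: "basis_set sc (u ` {..d})" "card (u ` {..d}) = d + 1"
    using assms(8) by (auto simp: split_basis_def card_image)
  have "spectral_resolution smul act d A E \<theta>" "spectral_resolution smul act d As Es \<theta>s"
    using eigenvalue_sequence_resolution[OF basis(1) _ basis(2)] assms(5,6) by auto
  moreover have "irreducible_tridiagonal d E As" "irreducible_tridiagonal d Es A"
    using assms(4) by (auto simp: leonard_system_def irreducible_tridiagonal_def)
  ultimately have "tridiagonal_resolution smul act d A E \<theta> As"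
    "tridiagonal_resolution smul act d As Es \<theta>s A"
    using faithful by (auto simp: tridiagonal_resolution_def tridiagonal_resolution_axioms_def)
  then interpret split_leonard_system smul act d A E \<theta> As Es \<theta>s u \<phi>
    using assms(7,8) algebra_module_axioms
    by (simp add: split_leonard_system_def split_leonard_system_axioms_def)
  show ?thesis
    unfolding \<Delta>_def \<nu>_def \<nu>dd_def using matrix_unit_via_E0 matrix_unit_via_Ed by blast
qed

end
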